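(* Let $M$ be any infinite mutually algebraic $L$-structure, elementarily embedded in a much larger saturated model $\mathfrak{C}$. 1. If $M\subseteq A\subseteq\mathfrak{C}$ and $A\setminus M$ is an arbitrary union of $\approx$-classes, then $A$ is (the universe of) an $L$-structure (a substructure of $\mathfrak{C}$) and $M\preceq A\preceq\mathfrak{C}$. 2. Conversely, if $M\preceq N\preceq\mathfrak{C}$ and $B\subseteq N\setminus M$ is a set of $\approx$-representatives (exactly one element from each $\approx$-class meeting $N\setminus M$), then $N$ is the disjoint union of the sets $M$ and $\mathrm{acl}_M(\{b\})\setminus M$ for $b\in B$, where $\mathrm{acl}_M(\{b\})$ denotes $\mathrm{acl}(M\cup\{b\})$.
   Context: $L(M)$ is $L$ with a constant symbol for each element of $M$, and $M_M$ is the canonical expansion of $M$ to an $L(M)$-structure. For a set $A$ and $n\ge1$, a subset $B\subseteq A^n$ is mutually algebraic if there is an integer $K$ such that for every partition $X\sqcup Y=\{1,\dots,n\}$ into two nonempty disjoint sets, the projection $\pi_Y$ onto the coordinates in $Y$, restricted to $B$, is at most $K$-to-1. An $L(M)$-formula $\varphi(\bar z)$ (with displayed tuple of distinct variables, $\lg(\bar z)\ge1$) is mutually algebraic if its solution set $\varphi(M)$ is a mutually algebraic subset of $M^{\lg(\bar z)}$; $\mathcal{MA}(M)$ is the set of all such formulas. $\mathcal{MA}^*(M)$ is the set of all $L(M)$-formulas that are $Th(M_M)$-equivalent to a boolean combination of formulas from $\mathcal{MA}(M)$ (the formulas in the combination may use different subtuples of the free variables). $M$ is a mutually algebraic structure if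 every $L(M)$-formula is in $\mathcal{MA}^*(M)$. For $B\subseteq\mathfrak{C}$, $\mathrm{acl}_M(B)$ abbreviates the model-theoretic algebraic closure $\mathrm{acl}(M\cup B)$, computed in $\mathfrak{C}$. The relation $a\approx b$ on $\mathfrak{C}\setminus M$ is defined by $a\in\mathrm{acl}_M(\{b\})$; for mutually algebraic $M$ it is an equivalence relation. *)

theory Defs
  imports Main "HOL-Library.Equipollence" "HOL-Library.Disjoint_Sets"
begin

text \<open>
  First-order logic with equality over an arbitrary signature. Constants are function symbols
  of arity 0, variables are natural numbers.
\<close>

record ('f, 'r) lang =
  funs :: "'f set"
  farity :: "'f \<Rightarrow> nat"
  rels :: "'r set"
  rarity :: "'r \<Rightarrow> nat"

datatype 'f tm = Var nat | Fun 'f "'f tm list"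

datatype ('f, 'r) fm =
    Eq "'f tm" "'f tm"
  | Rel 'r "'f tm list"
  | Neg "('f, 'r) fm"
  | Conj "('f, 'r) fm" "('f, 'r) fm"
  | Ex nat "('f, 'r) fm"

primrec wf_tm :: "('f, 'r) lang \<Rightarrow> 'f tm \<Rightarrow> bool" where
  "wf_tm L (Var i) \<longleftrightarrow> True"
| "wf_tm L (Fun f ts) \<longleftrightarrow> f \<in> funs L \<and> length ts = farity L f \<and> list_all (wf_tm L) ts"

primrec wf_fm :: "('f, 'r) lang \<Rightarrow> ('f, 'r) fm \<Rightarrow> bool" where
  "wf_fm L (Eq s t) \<longleftrightarrow> wf_tm L s \<and> wf_tm L t"
| "wf_fm L (Rel r ts) \<longleftrightarrow> r \<in> rels L \<and> length ts = rarity L r \<and> list_all (wf_tm L) ts"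
| "wf_fm L (Neg \<phi>) \<longleftrightarrow> wf_fm L \<phi>"
| "wf_fm L (Conj \<phi> \<psi>) \<longleftrightarrow> wf_fm L \<phi> \<and> wf_fm L \<psi>"
| "wf_fm L (Ex i \<phi>) \<longleftrightarrow> wf_fm L \<phi>"

primrec fv_tm :: "'f tm \<Rightarrow> nat set" where
  "fv_tm (Var i) = {i}"
| "fv_tm (Fun f ts) = \<Union> (set (map fv_tm ts))"

primrec fv :: "('f, 'r) fm \<Rightarrow> nat set" where
  "fv (Eq s t) = fv_tm s \<union> fv_tm t"
| "fv (Rel r ts) = \<Union> (set (map fv_tm ts))"
| "fv (Neg \<phi>) = fv \<phi>"
| "fv (Conj \<phi> \<psi>) = fv \<phi> \<union> fv \<psi>"
| "fv (Ex i \<phi>) = fv \<phi> - {i}"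

text \<open>
  The interpretations are total functions on the ambient type; only their values on tuples of
  the right length from the universe matter.
\<close>

record ('a, 'f, 'r) fo_struct =
  univ :: "'a set"
  fint :: "'f \<Rightarrow> 'a list \<Rightarrow> 'a"
  rint :: "'r \<Rightarrow> 'a list \<Rightarrow> bool"

definition is_struct :: "('f, 'r) lang \<Rightarrow> ('a, 'f, 'r) fo_struct \<Rightarrow> bool" where
  "is_struct L M \<longleftrightarrow> univ M \<noteq> {} \<and>
    (\<forall>f as. f \<in> funs L \<and> length as = farity L f \<and> set as \<subseteq> univ M \<longrightarrow> fint M f as \<in> univ M)"

primrec eval_tm :: "('a, 'f, 'r) fo_struct \<Rightarrow> (nat \<Rightarrow> 'a) \<Rightarrow> 'f tm \<Rightarrow> 'a" where
  "eval_tm M v (Var i) = v i"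
| "eval_tm M v (Fun f ts) = fint M f (map (eval_tm M v) ts)"

primrec sat :: "('a, 'f, 'r) fo_struct \<Rightarrow> (nat \<Rightarrow> 'a) \<Rightarrow> ('f, 'r) fm \<Rightarrow> bool" where
  "sat M v (Eq s t) \<longleftrightarrow> eval_tm M v s = eval_tm M v t"
| "sat M v (Rel r ts) \<longleftrightarrow> rint M r (map (eval_tm M v) ts)"
| "sat M v (Neg \<phi>) \<longleftrightarrow> \<not> sat M v \<phi>"
| "sat M v (Conj \<phi> \<psi>) \<longleftrightarrow> sat M v \<phi> \<and> sat M v \<psi>"
| "sat M v (Ex i \<phi>) \<longleftrightarrow> (\<exists>a\<in>univ M. sat M (v(i := a)) \<phi>)"

definition substruct :: "('f, 'r) lang \<Rightarrow> ('a, 'f, 'r) fo_struct \<Rightarrow> ('a, 'f, 'r) fo_struct \<Rightarrow> bool" where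
  "substruct L M N \<longleftrightarrow> is_struct L M \<and> is_struct L N \<and> univ M \<subseteq> univ N \<and>
    (\<forall>f as. f \<in> funs L \<and> length as = farity L f \<and> set as \<subseteq> univ M \<longrightarrow> fint M f as = fint N f as) \<and>
    (\<forall>r as. r \<in> rels L \<and> length as = rarity L r \<and> set as \<subseteq> univ M \<longrightarrow> rint M r as = rint N r as)"

definition elem_substruct :: "('f, 'r) lang \<Rightarrow> ('a, 'f, 'r) fo_struct \<Rightarrow> ('a, 'f, 'r) fo_struct \<Rightarrow> bool" where
  "elem_substruct L M N \<longleftrightarrow> substruct L M N \<and>
    (\<forall>\<phi> v. wf_fm L \<phi> \<and> range v \<subseteq> univ M \<longrightarrow> (sat M v \<phi> \<longleftrightarrow> sat N v \<phi>))"

text \<open>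
  Expansions by constants. The new constant naming \<open>a\<close> is \<open>Inr a\<close>; \<open>with_consts\<close> interprets
  every \<open>Inr a\<close> by \<open>a\<close>, and the language decides which of these symbols may be used. So
  \<open>add_consts L (univ M)\<close> and \<open>with_consts M\<close> are $L(M)$ and $M_M$.
\<close>

definition add_consts :: "('f, 'r) lang \<Rightarrow> 'a set \<Rightarrow> ('f + 'a, 'r) lang" where
  "add_consts L A =
    \<lparr>funs = Inl ` funs L \<union> Inr ` A, farity = case_sum (farity L) (\<lambda>_. 0),
     rels = rels L, rarity = rarity L\<rparr>"

definition with_consts :: "('a, 'f, 'r) fo_struct \<Rightarrow> ('a, 'f + 'a, 'r) fo_struct" where
  "with_consts M =
    \<lparr>univ = univ M, fint = case_sum (fint M) (\<lambda>a _. a), rint = rint M\<rparr>"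

text \<open>
  The solution set of \<open>\<phi>\<close> with displayed variables \<open>zs\<close>; used only when \<open>zs\<close> is distinct and
  contains all free variables of \<open>\<phi>\<close>.
\<close>

definition solutions :: "('a, 'f, 'r) fo_struct \<Rightarrow> ('f, 'r) fm \<Rightarrow> nat list \<Rightarrow> 'a list set" where
  "solutions M \<phi> zs = {map v zs | v. range v \<subseteq> univ M \<and> sat M v \<phi>}"

definition acl :: "('f, 'r) lang \<Rightarrow> ('a, 'f, 'r) fo_struct \<Rightarrow> 'a set \<Rightarrow> 'a set" where
  "acl L C X = {c \<in> univ C. \<exists>\<phi> x. wf_fm (add_consts L X) \<phi> \<and> fv \<phi> \<subseteq> {x} \<and>
      finite (solutions (with_consts C) \<phi> [x]) \<and> [c] \<in> solutions (with_consts C) \<phi> [x]}"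

text \<open>
  Saturation in the power of the universe; \<open>p\<close> ranges over (not necessarily complete) 1-types
  over \<open>X\<close>.
\<close>

definition saturated :: "('f, 'r) lang \<Rightarrow> ('a, 'f, 'r) fo_struct \<Rightarrow> bool" where
  "saturated L C \<longleftrightarrow> is_struct L C \<and>
    (\<forall>X x p. X \<subseteq> univ C \<and> X \<prec> univ C \<and>
        (\<forall>\<phi>\<in>p. wf_fm (add_consts L X) \<phi> \<and> fv \<phi> \<subseteq> {x}) \<and>
        (\<forall>q. q \<subseteq> p \<and> finite q \<longrightarrow> (\<exists>c\<in>univ C. \<forall>\<phi>\<in>q. [c] \<in> solutions (with_consts C) \<phi> [x]))
      \<longrightarrow> (\<exists>c\<in>univ C. \<forall>\<phi>\<in>p. [c] \<in> solutions (with_consts C) \<phi> [x]))"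

definition Th :: "('f, 'r) lang \<Rightarrow> ('a, 'f, 'r) fo_struct \<Rightarrow> ('f, 'r) fm set" where
  "Th L M = {\<sigma>. wf_fm L \<sigma> \<and> fv \<sigma> = {} \<and> (\<forall>v. range v \<subseteq> univ M \<longrightarrow> sat M v \<sigma>)}"

text \<open>
  Equivalence in all models of \<open>Th L M\<close>. A definition cannot quantify over types, so the models
  live on the type of \<open>M\<close>; this is no restriction, since \<open>M\<close> itself is among them and \<open>Th L M\<close>
  is complete.
\<close>

definition Th_equiv :: "('f, 'r) lang \<Rightarrow> ('a, 'f, 'r) fo_struct \<Rightarrow> ('f, 'r) fm \<Rightarrow> ('f, 'r) fm \<Rightarrow> bool" where
  "Th_equiv L M \<phi> \<psi> \<longleftrightarrow>
    (\<forall>N :: ('a, 'f, 'r) fo_struct. is_struct L N \<and> Th L M \<subseteq> Th L N \<longrightarrow>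
      (\<forall>v. range v \<subseteq> univ N \<longrightarrow> (sat N v \<phi> \<longleftrightarrow> sat N v \<psi>)))"

text \<open>
  Subsets of $A^n$ are sets of lists of length \<open>n\<close>, with coordinates indexed by \<open>{..<n}\<close>;
  \<open>\<lambda>b. nths b Y\<close> is the projection onto the coordinates in \<open>Y\<close>.
\<close>

definition mut_alg_set :: "'a set \<Rightarrow> nat \<Rightarrow> 'a list set \<Rightarrow> bool" where
  "mut_alg_set A n B \<longleftrightarrow> B \<subseteq> {b. length b = n \<and> set b \<subseteq> A} \<and>
    (\<exists>K. \<forall>X Y. X \<union> Y = {..<n} \<and> X \<inter> Y = {} \<and> X \<noteq> {} \<and> Y \<noteq> {} \<longrightarrow>
      (\<forall>c. finite {b \<in> B. nths b Y = c} \<and> card {b \<in> B. nths b Y = c} \<le> K))"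

definition MA :: "('f, 'r) lang \<Rightarrow> ('a, 'f, 'r) fo_struct \<Rightarrow> ('f + 'a, 'r) fm set" where
  "MA L M = {\<phi>. wf_fm (add_consts L (univ M)) \<phi> \<and>
    (\<exists>zs. zs \<noteq> [] \<and> distinct zs \<and> fv \<phi> \<subseteq> set zs \<and>
      mut_alg_set (univ M) (length zs) (solutions (with_consts M) \<phi> zs))}"

inductive_set bool_combs :: "('f, 'r) fm set \<Rightarrow> ('f, 'r) fm set" for S where
  "\<phi> \<in> S \<Longrightarrow> \<phi> \<in> bool_combs S"
| "\<phi> \<in> bool_combs S \<Longrightarrow> Neg \<phi> \<in> bool_combs S"
| "\<phi> \<in> bool_combs S \<Longrightarrow> \<psi> \<in> bool_combs S \<Longrightarrow> Conj \<phi> \<psi> \<in> bool_combs S"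

definition MA_star :: "('f, 'r) lang \<Rightarrow> ('a, 'f, 'r) fo_struct \<Rightarrow> ('f + 'a, 'r) fm set" where
  "MA_star L M = {\<phi>. wf_fm (add_consts L (univ M)) \<phi> \<and>
    (\<exists>\<psi>\<in>bool_combs (MA L M). Th_equiv (add_consts L (univ M)) (with_consts M) \<phi> \<psi>)}"

definition mut_alg_struct :: "('f, 'r) lang \<Rightarrow> ('a, 'f, 'r) fo_struct \<Rightarrow> bool" where
  "mut_alg_struct L M \<longleftrightarrow> is_struct L M \<and>
    (\<forall>\<phi>. wf_fm (add_consts L (univ M)) \<phi> \<longrightarrow> \<phi> \<in> MA_star L M)"

definition acl_rel :: "('f, 'r) lang \<Rightarrow> ('a, 'f, 'r) fo_struct \<Rightarrow> ('a, 'f, 'r) fo_struct \<Rightarrow> ('a \<times> 'a) set" where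
  "acl_rel L M C =
    {(a, b). a \<in> univ C - univ M \<and> b \<in> univ C - univ M \<and> a \<in> acl L C (univ M \<union> {b})}"

abbreviation acl_classes :: "('f, 'r) lang \<Rightarrow> ('a, 'f, 'r) fo_struct \<Rightarrow> ('a, 'f, 'r) fo_struct \<Rightarrow> 'a set set" where
  "acl_classes L M C \<equiv> (univ C - univ M) // acl_rel L M C"

end

theory Submission
  imports Defs
begin

text \<open>
  Everything rests on one consequence of mutual algebraicity. Let \<open>\<phi>\<close> be a formula with
  parameters from $M$ that holds in $\mathfrak{C}$ of a tuple whose coordinate $c$ at the variable
  $x$ lies outside $M$, and write \<open>\<phi>\<close> as a boolean combination of mutually algebraic formulas.
  Suppose that none of these that has $x$ together with another displayed variable is true
  of the tuple. By mutual algebraicity each of them becomes true for only finitely many values of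
  $x$ in place of $c$. The remaining constituents say something about $x$ alone or nothing about
  $x$; the conjunction \<open>\<delta>(x)\<close> of what is true of $c$ among the former is an \<open>L(M)\<close>-formula with the
  solution \<open>c \<notin> M\<close>, so it has infinitely many solutions in $M$, and all but finitely many of these
  satisfy \<open>\<phi>\<close> in place of $c$. So either \<open>\<phi>\<close> has infinitely many such solutions in $M$, or $c$ is
  tied to another coordinate of the tuple by a true mutually algebraic formula
  (\<open>linked_or_infinitely_many\<close>). In the second case the formula has finite fibres over each of the
  two coordinates, hence the tie, called \<open>linked\<close> below, is symmetric and each of the two elements
  is algebraic over $M$ and the other.

  Applied to a formula that witnesses \<open>e \<in> acl(M \<union> {b})\<close>, where the first alternative is absurd, this
  says that $e$ and $b$ are linked if \<open>e \<notin> M\<close>. Conversely two links in succession compose to an algebraic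
  formula. So whatever is linked to an element of a union $A$ of $M$ and some classes belongs to $A$.
  That is the Tarski-Vaught test for $A$: a witness in $\mathfrak{C}$ of an existential formula with
  parameters in $A$ is itself in $A$, or is linked to one of the parameters and thus lies in $A$, or can be
  replaced by an element of $M$.

  For the second part, elementary substructures are algebraically closed, which bounds the pieces
  by $N$, and the class of $e$ is by definition the set of all $b$ with
  \<open>e \<in> acl(M \<union> {b})\<close>: that the class of $e$ meets the set of representatives in exactly one point
  gives both the covering of $N$ and the disjointness of its pieces.

  Passing between $M$ and $\mathfrak{C}$ takes two finiteness transfers: a definable set with
  finitely many elements in $M$ acquires no new ones, and a uniform bound on the size of definable fibres persists, since
  its failure is expressed by a formula stating that there are too many distinct points in a fibre.
\<close>

section \<open>Syntax and semantics\<close>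

lemma with_consts_simps [simp]:
  "univ (with_consts M) = univ M"
  "fint (with_consts M) (Inl f) = fint M f"
  "fint (with_consts M) (Inr a) ts = a"
  "rint (with_consts M) = rint M"
  by (simp_all add: with_consts_def)

lemma add_consts_simps [simp]:
  "Inl f \<in> funs (add_consts L X) \<longleftrightarrow> f \<in> funs L"
  "Inr a \<in> funs (add_consts L X) \<longleftrightarrow> a \<in> X"
  "farity (add_consts L X) (Inl f) = farity L f"
  "farity (add_consts L X) (Inr a) = 0"
  "rels (add_consts L X) = rels L"
  "rarity (add_consts L X) = rarity L"
  by (auto simp: add_consts_def)

lemma range_fun_upd_subset: "range v \<subseteq> A \<Longrightarrow> a \<in> A \<Longrightarrow> range (v(i := a)) \<subseteq> A"
  by auto

lemma is_struct_with_consts: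
  "is_struct L M \<Longrightarrow> X \<subseteq> univ M \<Longrightarrow> is_struct (add_consts L X) (with_consts M)"
  unfolding is_struct_def by (auto simp: add_consts_def with_consts_def split: sum.splits)

lemma wf_tm_add_consts_mono:
  "wf_tm (add_consts L X) t \<Longrightarrow> X \<subseteq> Y \<Longrightarrow> wf_tm (add_consts L Y) t"
proof (induction t)
  case (Fun s ts)
  then show ?case by (cases s) (auto simp: list_all_iff)
qed simp

lemma wf_fm_add_consts_mono:
  "wf_fm (add_consts L X) \<phi> \<Longrightarrow> X \<subseteq> Y \<Longrightarrow> wf_fm (add_consts L Y) \<phi>"
  by (induction \<phi>) (auto simp: list_all_iff intro: wf_tm_add_consts_mono)

lemma finite_fv_tm [simp]: "finite (fv_tm t)"
  by (induction t) auto

lemma finite_fv [simp]: "finite (fv \<phi>)"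
  by (induction \<phi>) auto

lemma eval_tm_cong: "(\<And>i. i \<in> fv_tm t \<Longrightarrow> v i = w i) \<Longrightarrow> eval_tm M v t = eval_tm M w t"
proof (induction t)
  case (Fun f ts)
  then have "map (eval_tm M v) ts = map (eval_tm M w) ts" by auto
  then show ?case by (simp only: eval_tm.simps)
qed simp

lemma sat_cong: "(\<And>i. i \<in> fv \<phi> \<Longrightarrow> v i = w i) \<Longrightarrow> sat M v \<phi> \<longleftrightarrow> sat M w \<phi>"
proof (induction \<phi> arbitrary: v w)
  case (Eq s t)
  then show ?case using eval_tm_cong[of s v w M] eval_tm_cong[of t v w M] by auto
next
  case (Rel r ts)
  then have "map (eval_tm M v) ts = map (eval_tm M w) ts" by (auto intro!: eval_tm_cong)
  then show ?case by (simp only: sat.simps)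
next
  case (Neg \<phi>)
  then show ?case by (metis fv.simps(3) sat.simps(3))
next
  case (Conj \<phi>1 \<phi>2)
  then show ?case by (metis UnCI fv.simps(4) sat.simps(4))
next
  case (Ex i \<phi>)
  have "sat M (v(i := a)) \<phi> \<longleftrightarrow> sat M (w(i := a)) \<phi>" for a
    using Ex.prems by (intro Ex.IH) auto
  then show ?case by simp
qed

lemma solutionsI: "range v \<subseteq> univ M \<Longrightarrow> sat M v \<phi> \<Longrightarrow> map v zs \<in> solutions M \<phi> zs"
  by (auto simp: solutions_def)

text \<open>
  Existential closure over a finite set of variables. Its semantics below is in terms of a single
  assignment, which makes it usable in place of a renaming of variables: the variables of a
  formula are quantified away after being equated with fresh ones.
\<close>

definition exs :: "nat set \<Rightarrow> ('f, 'r) fm \<Rightarrow> ('f, 'r) fm" where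
  "exs F \<phi> = foldr Ex (sorted_list_of_set F) \<phi>"

lemma wf_exs [simp]: "wf_fm L (exs F \<phi>) \<longleftrightarrow> wf_fm L \<phi>"
proof -
  have "wf_fm L (foldr Ex xs \<phi>) \<longleftrightarrow> wf_fm L \<phi>" for xs by (induction xs) auto
  then show ?thesis by (simp add: exs_def)
qed

lemma fv_exs [simp]: "finite F \<Longrightarrow> fv (exs F \<phi>) = fv \<phi> - F"
proof -
  assume "finite F"
  have "fv (foldr Ex xs \<phi>) = fv \<phi> - set xs" for xs by (induction xs) auto
  then show ?thesis using \<open>finite F\<close> by (simp add: exs_def)
qed

lemma sat_exs:
  assumes "finite F" "range v \<subseteq> univ M"
  shows "sat M v (exs F \<phi>) \<longleftrightarrow> (\<exists>w. range w \<subseteq> univ M \<and> (\<forall>i. i \<notin> F \<longrightarrow> w i = v i) \<and> sat M w \<phi>)"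
proof -
  have "sat M v (foldr Ex xs \<phi>) \<longleftrightarrow>
      (\<exists>w. range w \<subseteq> univ M \<and> (\<forall>i. i \<notin> set xs \<longrightarrow> w i = v i) \<and> sat M w \<phi>)"
    if "range v \<subseteq> univ M" for xs v
    using that
  proof (induction xs arbitrary: v)
    case Nil
    have "w = v" if "\<forall>i. w i = v i" for w using that by auto
    then show ?case using Nil by auto
  next
    case (Cons x xs)
    have upd: "range (v(x := a)) \<subseteq> univ M" if "a \<in> univ M" for a
      using that Cons.prems by auto
    show ?case (is "?l \<longleftrightarrow> ?r")
    proof
      assume ?l
      then obtain a where a: "a \<in> univ M" "sat M (v(x := a)) (foldr Ex xs \<phi>)" by auto
      then obtain w where "range w \<subseteq> univ M" "\<forall>i. i \<notin> set xs \<longrightarrow> w i = (v(x := a)) i" "sat M w \<phi>"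
        using Cons.IH[OF upd[OF a(1)]] by blast
      then show ?r by (intro exI[of _ w]) auto
    next
      assume ?r
      then obtain w where w: "range w \<subseteq> univ M" "\<forall>i. i \<notin> set (x # xs) \<longrightarrow> w i = v i" "sat M w \<phi>"
        by blast
      then have a: "w x \<in> univ M" by auto
      have "sat M (v(x := w x)) (foldr Ex xs \<phi>)"
        unfolding Cons.IH[OF upd[OF a]] using w by (intro exI[of _ w]) auto
      then show ?l using a by auto
    qed
  qed
  from this[OF assms(2), of "sorted_list_of_set F"] show ?thesis
    using assms(1) by (simp add: exs_def)
qed

definition conjs :: "('f, 'r) fm \<Rightarrow> ('f, 'r) fm list \<Rightarrow> ('f, 'r) fm" where
  "conjs \<phi> \<psi>s = foldr Conj \<psi>s \<phi>"

lemma wf_conjs [simp]: "wf_fm L (conjs \<phi> \<psi>s) \<longleftrightarrow> wf_fm L \<phi> \<and> (\<forall>\<psi>\<in>set \<psi>s. wf_fm L \<psi>)"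
  unfolding conjs_def by (induction \<psi>s) auto

lemma sat_conjs [simp]: "sat M v (conjs \<phi> \<psi>s) \<longleftrightarrow> sat M v \<phi> \<and> (\<forall>\<psi>\<in>set \<psi>s. sat M v \<psi>)"
  unfolding conjs_def by (induction \<psi>s) auto

lemma fv_conjs [simp]: "fv (conjs \<phi> \<psi>s) = fv \<phi> \<union> (\<Union>\<psi>\<in>set \<psi>s. fv \<psi>)"
  unfolding conjs_def by (induction \<psi>s) auto

section \<open>Trading constants for variables\<close>

abbreviation lift_fm :: "('f, 'r) fm \<Rightarrow> ('f + 'a, 'r) fm" where
  "lift_fm \<equiv> map_fm Inl id"

lemma eval_lift [simp]: "eval_tm (with_consts M) v (map_tm Inl t) = eval_tm M v t"
proof (induction t)
  case (Fun f ts)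
  then have "map (eval_tm (with_consts M) v \<circ> map_tm Inl) ts = map (eval_tm M v) ts" by auto
  then show ?case by (simp del: map_eq_conv)
qed simp

lemma sat_lift [simp]: "sat (with_consts M) v (lift_fm \<phi>) \<longleftrightarrow> sat M v \<phi>"
  by (induction \<phi> arbitrary: v) (auto simp: comp_def)

lemma wf_lift_tm: "wf_tm L t \<Longrightarrow> wf_tm (add_consts L X) (map_tm Inl t)"
  by (induction t) (auto simp: list_all_iff)

lemma wf_lift: "wf_fm L \<phi> \<Longrightarrow> wf_fm (add_consts L X) (lift_fm \<phi>)"
  by (induction \<phi>) (auto simp: list_all_iff wf_lift_tm)

text \<open>
  The old variables are moved to the even indices and the constant naming \<open>a\<close> becomes an odd
  variable, so bound variables cannot capture the new ones. An enumeration \<open>g\<close> of the finitely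
  many constants in question supplies both the index of each new variable and, in \<open>interleave\<close>, the
  values of these variables.
\<close>

primrec unconst_tm :: "(nat \<Rightarrow> 'a) \<Rightarrow> ('f + 'a) tm \<Rightarrow> 'f tm" where
  "unconst_tm g (Var i) = Var (2 * i)"
| "unconst_tm g (Fun s ts) =
    (case s of Inl f \<Rightarrow> Fun f (map (unconst_tm g) ts) | Inr a \<Rightarrow> Var (2 * inv g a + 1))"

primrec unconst :: "(nat \<Rightarrow> 'a) \<Rightarrow> ('f + 'a, 'r) fm \<Rightarrow> ('f, 'r) fm" where
  "unconst g (Eq s t) = Eq (unconst_tm g s) (unconst_tm g t)"
| "unconst g (Rel r ts) = Rel r (map (unconst_tm g) ts)"
| "unconst g (Neg \<phi>) = Neg (unconst g \<phi>)"
| "unconst g (Conj \<phi> \<psi>) = Conj (unconst g \<phi>) (unconst g \<psi>)"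
| "unconst g (Ex i \<phi>) = Ex (2 * i) (unconst g \<phi>)"

definition interleave :: "(nat \<Rightarrow> 'a) \<Rightarrow> (nat \<Rightarrow> 'a) \<Rightarrow> nat \<Rightarrow> 'a" where
  "interleave v g j = (if even j then v (j div 2) else g (j div 2))"

lemma interleave_simps [simp]:
  "interleave v g (2 * i) = v i"
  "interleave v g (Suc (2 * i)) = g i"
  by (auto simp: interleave_def)

lemma interleave_upd: "interleave (v(i := a)) g = (interleave v g)(2 * i := a)"
  by (auto simp: interleave_def fun_eq_iff)

lemma range_interleave: "range (interleave v g) \<subseteq> range v \<union> range g"
  by (auto simp: interleave_def)

lemma wf_unconst_tm: "wf_tm (add_consts L X) t \<Longrightarrow> wf_tm L (unconst_tm g t)"
proof (induction t)
  case (Fun s ts)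
  then show ?case by (cases s) (auto simp: list_all_iff)
qed simp

lemma wf_unconst: "wf_fm (add_consts L X) \<phi> \<Longrightarrow> wf_fm L (unconst g \<phi>)"
  by (induction \<phi>) (auto simp: list_all_iff wf_unconst_tm)

lemma eval_unconst:
  "{a. Inr a \<in> set_tm t} \<subseteq> range g \<Longrightarrow>
    eval_tm M (interleave v g) (unconst_tm g t) = eval_tm (with_consts M) v t"
proof (induction t)
  case (Fun s ts)
  show ?case
  proof (cases s)
    case (Inl f)
    have "eval_tm M (interleave v g) (unconst_tm g t) = eval_tm (with_consts M) v t"
      if "t \<in> set ts" for t
      using that Fun.prems by (intro Fun.IH) auto
    then have "map (eval_tm M (interleave v g) \<circ> unconst_tm g) ts = map (eval_tm (with_consts M) v) ts"
      by auto
    then show ?thesis using Inl by (simp del: map_eq_conv)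
  next
    case (Inr a)
    then have "a \<in> range g" using Fun.prems by auto
    then show ?thesis using Inr by (simp add: f_inv_into_f)
  qed
qed simp

lemma sat_unconst:
  "{a. Inr a \<in> set1_fm \<phi>} \<subseteq> range g \<Longrightarrow>
    sat M (interleave v g) (unconst g \<phi>) \<longleftrightarrow> sat (with_consts M) v \<phi>"
proof (induction \<phi> arbitrary: v)
  case (Eq s t)
  then have "eval_tm M (interleave v g) (unconst_tm g s) = eval_tm (with_consts M) v s"
    "eval_tm M (interleave v g) (unconst_tm g t) = eval_tm (with_consts M) v t"
    by (auto intro!: eval_unconst)
  then show ?case by simp
next
  case (Rel r ts)
  have "eval_tm M (interleave v g) (unconst_tm g t) = eval_tm (with_consts M) v t"
    if "t \<in> set ts" for t
    using that Rel.prems by (intro eval_unconst) auto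
  then have "map (eval_tm M (interleave v g) \<circ> unconst_tm g) ts = map (eval_tm (with_consts M) v) ts"
    by auto
  then show ?case by (simp del: map_eq_conv)
next
  case (Neg \<phi>)
  then show ?case by simp
next
  case (Conj \<phi>1 \<phi>2)
  then have "{a. Inr a \<in> set1_fm \<phi>1} \<subseteq> range g" "{a. Inr a \<in> set1_fm \<phi>2} \<subseteq> range g" by auto
  with Conj.IH show ?case by simp
next
  case (Ex i \<phi>)
  then have "{a. Inr a \<in> set1_fm \<phi>} \<subseteq> range g" by auto
  with Ex.IH show ?case by (simp flip: interleave_upd)
qed

lemma consts_tm_subset: "wf_tm (add_consts L X) t \<Longrightarrow> Inr a \<in> set_tm t \<Longrightarrow> a \<in> X"
proof (induction t)
  case (Fun s ts)
  then show ?case by (cases s) (auto simp: list_all_iff)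
qed simp

lemma consts_subset: "wf_fm (add_consts L X) \<phi> \<Longrightarrow> Inr a \<in> set1_fm \<phi> \<Longrightarrow> a \<in> X"
  by (induction \<phi>) (auto simp: list_all_iff dest: consts_tm_subset)

lemma finite_set_tm: "finite (set_tm t)"
  by (induction t) auto

lemma finite_set1_fm: "finite (set1_fm \<phi>)"
  by (induction \<phi>) (auto simp: finite_set_tm)

lemma enumerate_consts:
  assumes "wf_fm (add_consts L X) \<phi>" "X \<noteq> {}"
  obtains g :: "nat \<Rightarrow> 'a" where "range g \<subseteq> X" "{a. Inr a \<in> set1_fm \<phi>} \<subseteq> range g"
proof -
  obtain x0 where "x0 \<in> X" using assms(2) by auto
  let ?A = "insert x0 {a. Inr a \<in> set1_fm \<phi>}"
  have "finite (Inr -` set1_fm \<phi>)" by (intro finite_vimageI finite_set1_fm) auto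
  then have "countable ?A" by (simp add: vimage_def countable_finite)
  then have "range (from_nat_into ?A) = ?A" by (intro range_from_nat_into) auto
  moreover have "?A \<subseteq> X" using consts_subset[OF assms(1)] \<open>x0 \<in> X\<close> by auto
  ultimately show thesis by (intro that[of "from_nat_into ?A"]) auto
qed

section \<open>Fibres of formulas\<close>

text \<open>
  The values of \<open>x\<close> compatible with the value \<open>a\<close> of \<open>z\<close>, the other variables being quantified
  existentially. Mutual algebraicity is used only through the finiteness of these sets.
\<close>

definition fibre :: "('a, 'f, 'r) fo_struct \<Rightarrow> ('f, 'r) fm \<Rightarrow> nat \<Rightarrow> nat \<Rightarrow> 'a \<Rightarrow> 'a set" where
  "fibre M \<theta> x z a = {w x |w. range w \<subseteq> univ M \<and> w z = a \<and> sat M w \<theta>}"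

lemma fibreI: "range w \<subseteq> univ M \<Longrightarrow> sat M w \<theta> \<Longrightarrow> w x \<in> fibre M \<theta> x z (w z)"
  by (auto simp: fibre_def)

text \<open>
  The formula defining the fibre relation in the two new variables \<open>p\<close> and \<open>q\<close>.
\<close>

definition fibre_fm :: "('f, 'r) fm \<Rightarrow> nat \<Rightarrow> nat \<Rightarrow> nat \<Rightarrow> nat \<Rightarrow> ('f, 'r) fm" where
  "fibre_fm \<theta> x z p q = exs (fv \<theta> \<union> {x, z}) (Conj (Eq (Var x) (Var p)) (Conj (Eq (Var z) (Var q)) \<theta>))"

lemma wf_fibre_fm [simp]: "wf_fm L (fibre_fm \<theta> x z p q) \<longleftrightarrow> wf_fm L \<theta>"
  by (simp add: fibre_fm_def)

lemma fv_fibre_fm: "fv (fibre_fm \<theta> x z p q) \<subseteq> {p, q}"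
  by (auto simp: fibre_fm_def)

lemma sat_fibre_fm:
  assumes "p \<notin> fv \<theta> \<union> {x, z}" "q \<notin> fv \<theta> \<union> {x, z}" "range v \<subseteq> univ M"
  shows "sat M v (fibre_fm \<theta> x z p q) \<longleftrightarrow> v p \<in> fibre M \<theta> x z (v q)"
proof
  assume "sat M v (fibre_fm \<theta> x z p q)"
  then obtain w where w: "range w \<subseteq> univ M" "\<forall>i. i \<notin> fv \<theta> \<union> {x, z} \<longrightarrow> w i = v i"
    "w x = w p" "w z = w q" "sat M w \<theta>"
    using assms(3) by (auto simp: fibre_fm_def sat_exs)
  then have "w x = v p" "w z = v q" using assms(1,2) by metis+
  then show "v p \<in> fibre M \<theta> x z (v q)" using fibreI[OF w(1,5), of x z] by simp
next
  assume "v p \<in> fibre M \<theta> x z (v q)"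
  then obtain w where w: "v p = w x" "range w \<subseteq> univ M" "w z = v q" "sat M w \<theta>"
    by (auto simp: fibre_def)
  \<comment> \<open>only the bound variables may change, since \<open>p\<close> and \<open>q\<close> must keep their values\<close>
  define u where "u i = (if i \<in> fv \<theta> \<union> {x, z} then w i else v i)" for i
  have "sat M u \<theta>" using w(4) sat_cong[of \<theta> u w M] by (simp add: u_def)
  moreover have "range u \<subseteq> univ M" using w(2) assms(3) by (auto simp: u_def)
  moreover have "u x = v p" "u z = v q" "u p = v p" "u q = v q" "\<And>i. i \<notin> fv \<theta> \<union> {x, z} \<Longrightarrow> u i = v i"
    using assms(1,2) w(1,3) by (simp_all add: u_def)
  ultimately show "sat M v (fibre_fm \<theta> x z p q)"
    unfolding fibre_fm_def by (subst sat_exs) (use assms(3) in \<open>auto intro!: exI[of _ u]\<close>)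
qed

lemma fresh_vars: "\<exists>N::nat. \<forall>i\<ge>N. i \<notin> fv \<theta> \<union> {x, z}"
proof -
  have "finite (fv \<theta> \<union> {x, z})" by simp
  then obtain N where "\<forall>i\<in>fv \<theta> \<union> {x, z}. i \<le> N" using finite_nat_set_iff_bounded_le by blast
  then have "\<forall>i\<ge>Suc N. i \<notin> fv \<theta> \<union> {x, z}" by fastforce
  then show ?thesis by blast
qed

section \<open>Elementary extensions\<close>

locale elementary_pair =
  fixes L :: "('f, 'r) lang" and M C :: "('a, 'f, 'r) fo_struct"
  assumes elem: "elem_substruct L M C"
begin

lemma univ_subset: "univ M \<subseteq> univ C"
  and struct_M: "is_struct L M" and struct_C: "is_struct L C"
  and univ_nonempty: "univ M \<noteq> {}"
  using elem by (auto simp: elem_substruct_def substruct_def is_struct_def)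

text \<open>
  $M_M \preceq \mathfrak{C}_M$: a formula with constants says the same as its constant-free
  version under an assignment of the named elements to the new variables.
\<close>

lemma sat_consts_iff:
  assumes "wf_fm (add_consts L (univ M)) \<phi>" "range v \<subseteq> univ M"
  shows "sat (with_consts M) v \<phi> \<longleftrightarrow> sat (with_consts C) v \<phi>"
proof -
  obtain g :: "nat \<Rightarrow> 'a" where g: "range g \<subseteq> univ M" "{a. Inr a \<in> set1_fm \<phi>} \<subseteq> range g"
    by (rule enumerate_consts[OF assms(1) univ_nonempty])
  have "range (interleave v g) \<subseteq> univ M" using range_interleave[of v g] g(1) assms(2) by blast
  then have "sat M (interleave v g) (unconst g \<phi>) \<longleftrightarrow> sat C (interleave v g) (unconst g \<phi>)"
    using elem wf_unconst[OF assms(1)] by (auto simp: elem_substruct_def)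
  then show ?thesis by (simp add: sat_unconst[OF g(2)])
qed

lemma Th_subset:
  "Th (add_consts L (univ M)) (with_consts M) \<subseteq> Th (add_consts L (univ M)) (with_consts C)"
proof
  fix \<sigma> assume "\<sigma> \<in> Th (add_consts L (univ M)) (with_consts M)"
  then have \<sigma>: "wf_fm (add_consts L (univ M)) \<sigma>" "fv \<sigma> = {}"
    "\<And>v. range v \<subseteq> univ M \<Longrightarrow> sat (with_consts M) v \<sigma>" by (auto simp: Th_def)
  obtain m where m: "m \<in> univ M" using univ_nonempty by auto
  then have "sat (with_consts C) (\<lambda>_. m) \<sigma>" using \<sigma>(3)[of "\<lambda>_. m"] sat_consts_iff[OF \<sigma>(1), of "\<lambda>_. m"] by auto
  then have "sat (with_consts C) v \<sigma>" for v using sat_cong[of \<sigma> v "\<lambda>_. m"] \<sigma>(2) by auto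
  then show "\<sigma> \<in> Th (add_consts L (univ M)) (with_consts C)" using \<sigma> by (auto simp: Th_def)
qed

lemma Th_equiv_sat:
  assumes "Th_equiv (add_consts L (univ M)) (with_consts M) \<phi> \<psi>" "range v \<subseteq> univ C"
  shows "sat (with_consts C) v \<phi> \<longleftrightarrow> sat (with_consts C) v \<psi>"
  using assms Th_subset is_struct_with_consts[OF struct_C univ_subset]
  unfolding Th_equiv_def by (metis with_consts_simps(1))

lemma satisfiable_descends:
  assumes "wf_fm (add_consts L (univ M)) \<phi>" "range v \<subseteq> univ C" "sat (with_consts C) v \<phi>"
  obtains w where "range w \<subseteq> univ M" "sat (with_consts M) w \<phi>"
proof -
  obtain m where m: "m \<in> univ M" using univ_nonempty by auto
  have "sat (with_consts C) v (exs (fv \<phi>) \<phi>)" using assms by (subst sat_exs) auto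
  then have "sat (with_consts C) (\<lambda>_. m) (exs (fv \<phi>) \<phi>)"
    using sat_cong[of "exs (fv \<phi>) \<phi>" v "\<lambda>_. m"] by simp
  then have "sat (with_consts M) (\<lambda>_. m) (exs (fv \<phi>) \<phi>)"
    using sat_consts_iff[of "exs (fv \<phi>) \<phi>" "\<lambda>_. m"] assms(1) m by auto
  then show thesis using m that by (subst (asm) sat_exs) auto
qed

text \<open>
  If the solutions of \<open>\<delta>\<close> in \<open>M\<close> are finitely many, they can be listed by constants, and the
  formula asserting a further solution fails in \<open>M\<close>, hence in \<open>C\<close>.
\<close>

lemma finitely_many_solutions_in:
  assumes wf: "wf_fm (add_consts L (univ M)) \<delta>" and v: "range v \<subseteq> univ C"
    and params: "\<And>i. i \<in> fv \<delta> - {x} \<Longrightarrow> v i \<in> univ M"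
    and sat: "sat (with_consts C) v \<delta>"
    and fin: "finite {m \<in> univ M. sat (with_consts C) (v(x := m)) \<delta>}"
  shows "v x \<in> univ M"
proof (rule ccontr)
  assume nin: "v x \<notin> univ M"
  obtain m where m: "m \<in> univ M" using univ_nonempty by auto
  obtain ms where ms: "set ms = {m \<in> univ M. sat (with_consts C) (v(x := m)) \<delta>}"
    using finite_list[OF fin] by auto
  define \<chi> where "\<chi> = Ex x (conjs \<delta> (map (\<lambda>m. Neg (Eq (Var x) (Fun (Inr m) []))) ms))"
  \<comment> \<open>elementarity needs an assignment with all its values in \<open>M\<close>, not just those that matter\<close>
  define w where "w i = (if i \<in> fv \<delta> - {x} then v i else m)" for i
  have w: "range w \<subseteq> univ M" using params m by (auto simp: w_def)
  have agree: "sat (with_consts C) (w(x := d)) \<delta> \<longleftrightarrow> sat (with_consts C) (v(x := d)) \<delta>" for d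
    by (intro sat_cong) (auto simp: w_def)
  have wf\<chi>: "wf_fm (add_consts L (univ M)) \<chi>" using wf ms by (auto simp: \<chi>_def)
  have vx: "v x \<in> univ C" using v by auto
  have "sat (with_consts C) (w(x := v x)) \<delta>" using agree[of "v x"] sat by simp
  then have "sat (with_consts C) w \<chi>" using nin vx ms by (auto simp: \<chi>_def intro!: bexI[of _ "v x"])
  then have "sat (with_consts M) w \<chi>" using sat_consts_iff[OF wf\<chi> w] by simp
  then obtain d where d: "d \<in> univ M" "sat (with_consts M) (w(x := d)) \<delta>" "d \<notin> set ms"
    by (auto simp: \<chi>_def)
  moreover have "range (w(x := d)) \<subseteq> univ M" using w d(1) by auto
  ultimately have "sat (with_consts C) (v(x := d)) \<delta>"
    using sat_consts_iff[OF wf] agree by blast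
  then show False using d ms by auto
qed

lemma acl_closed: assumes "X \<subseteq> univ M" shows "acl L C X \<subseteq> univ M"
proof
  fix c assume "c \<in> acl L C X"
  then obtain \<phi> x where \<phi>: "wf_fm (add_consts L X) \<phi>" "fv \<phi> \<subseteq> {x}"
    "finite (solutions (with_consts C) \<phi> [x])" "[c] \<in> solutions (with_consts C) \<phi> [x]"
    by (auto simp: acl_def)
  then obtain v where v: "range v \<subseteq> univ C" "sat (with_consts C) v \<phi>" "v x = c"
    by (auto simp: solutions_def)
  have "[m] \<in> solutions (with_consts C) \<phi> [x]"
    if m: "m \<in> univ M" "sat (with_consts C) (v(x := m)) \<phi>" for m
  proof -
    have "range (v(x := m)) \<subseteq> univ C" using range_fun_upd_subset[OF v(1)] m(1) univ_subset by blast
    from solutionsI[OF _ m(2), of "[x]"] this show ?thesis by simp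
  qed
  then have "{m \<in> univ M. sat (with_consts C) (v(x := m)) \<phi>} \<subseteq> hd ` solutions (with_consts C) \<phi> [x]"
    by force
  then have "finite {m \<in> univ M. sat (with_consts C) (v(x := m)) \<phi>}"
    using \<phi>(3) finite_surj by blast
  from finitely_many_solutions_in[OF wf_fm_add_consts_mono[OF \<phi>(1) assms] v(1) _ v(2) this]
  show "c \<in> univ M" using \<phi>(2) v(3) by auto
qed

text \<open>
  A uniform bound is essential here: an infinite fibre in \<open>C\<close> contains \<open>K + 1\<close> distinct points,
  which is a first-order property of the tuple consisting of these points and the base point, so
  some fibre in \<open>M\<close> would have \<open>K + 1\<close> points as well.
\<close>

lemma finite_fibre_ascends:
  assumes wf: "wf_fm (add_consts L (univ M)) \<theta>"
    and K: "\<And>a. finite (fibre (with_consts M) \<theta> x z a) \<and> card (fibre (with_consts M) \<theta> x z a) \<le> K"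
  shows "finite (fibre (with_consts C) \<theta> x z a)"
proof (rule ccontr)
  assume inf: "infinite (fibre (with_consts C) \<theta> x z a)"
  obtain T where T: "T \<subseteq> fibre (with_consts C) \<theta> x z a" "card T = Suc K" "finite T"
    using infinite_arbitrarily_large[OF inf] by blast
  obtain ds where ds: "set ds = T" "distinct ds" using finite_distinct_list[OF T(3)] by blast
  then have len: "length ds = Suc K" using T(2) distinct_card by fastforce
  obtain N where N: "\<And>i. i \<ge> N \<Longrightarrow> i \<notin> fv \<theta> \<union> {x, z}" using fresh_vars[of \<theta> x z] by blast
  \<comment> \<open>\<open>Var N\<close> is the base point and \<open>Var (N + Suc i)\<close> the \<open>i\<close>-th point of its fibre; the first
    conjunct is a trivial truth\<close>
  define \<chi> :: "('f + 'a, 'r) fm" where "\<chi> = conjs (Eq (Var N) (Var N))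
    (map (\<lambda>i. fibre_fm \<theta> x z (N + Suc i) N) [0..<Suc K] @
     map (\<lambda>(i, j). Neg (Eq (Var (N + Suc i)) (Var (N + Suc j))))
       (filter (\<lambda>(i, j). i \<noteq> j) (List.product [0..<Suc K] [0..<Suc K])))"
  have wf\<chi>: "wf_fm (add_consts L (univ M)) \<chi>" using wf by (auto simp: \<chi>_def)
  have sat\<chi>: "sat D u \<chi> \<longleftrightarrow> (\<forall>i<Suc K. u (N + Suc i) \<in> fibre D \<theta> x z (u N)) \<and>
      (\<forall>i<Suc K. \<forall>j<Suc K. i \<noteq> j \<longrightarrow> u (N + Suc i) \<noteq> u (N + Suc j))"
    if "range u \<subseteq> univ D" for u and D :: "('a, 'f + 'a, 'r) fo_struct"
    using sat_fibre_fm[OF N N that] by (auto simp: \<chi>_def ball_Un simp del: upt_Suc)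
  have "a \<in> univ C" "T \<subseteq> univ C"
    using inf T(1) not_finite_existsD unfolding fibre_def by fastforce+
  define v where "v i = (if i > N \<and> i \<le> N + Suc K then ds ! (i - Suc N) else a)" for i
  have v: "range v \<subseteq> univ C"
    using \<open>a \<in> univ C\<close> \<open>T \<subseteq> univ C\<close> ds(1) len nth_mem by (fastforce simp: v_def)
  have "v (N + Suc i) = ds ! i" if "i < Suc K" for i using that by (auto simp: v_def)
  moreover have "v N = a" by (simp add: v_def)
  moreover have "ds ! i \<in> fibre (with_consts C) \<theta> x z a" if "i < Suc K" for i
    using that T(1) ds(1) len by (metis nth_mem subsetD)
  ultimately have "sat (with_consts C) v \<chi>"
    using sat\<chi>[of v "with_consts C"] v ds(2) len by (simp add: nth_eq_iff_index_eq)
  then obtain u where u: "range u \<subseteq> univ M" "sat (with_consts M) u \<chi>"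
    using satisfiable_descends[OF wf\<chi> v] by blast
  let ?h = "\<lambda>i. u (N + Suc i)"
  have "inj_on ?h {..<Suc K}" "?h ` {..<Suc K} \<subseteq> fibre (with_consts M) \<theta> x z (u N)"
    using u(2) sat\<chi>[of u "with_consts M"] u(1) by (auto simp: inj_on_def)
  then have "card {..<Suc K} \<le> card (fibre (with_consts M) \<theta> x z (u N))"
    using K card_inj_on_le by blast
  then show False using K[of "u N"] by simp
qed

section \<open>Links\<close>

text \<open>
  Two elements are linked if they are coordinates of one solution of an \<open>L(M)\<close>-formula with finite
  fibres over both coordinates. Unlike algebraicity over \<open>M\<close> and
  one further element, this is symmetric by definition.
\<close>

definition linked :: "'a \<Rightarrow> 'a \<Rightarrow> bool" where
  "linked a b \<longleftrightarrow> (\<exists>\<theta> x z. wf_fm (add_consts L (univ M)) \<theta> \<and>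
    (\<forall>c. finite (fibre (with_consts C) \<theta> x z c) \<and> finite (fibre (with_consts C) \<theta> z x c)) \<and>
    a \<in> fibre (with_consts C) \<theta> x z b)"

lemma linked_sym: "linked a b \<Longrightarrow> linked b a"
  unfolding linked_def fibre_def by blast

lemma linked_to_base:
  assumes "linked a m" "m \<in> univ M" shows "a \<in> univ M"
proof -
  obtain \<theta> x z where \<theta>: "wf_fm (add_consts L (univ M)) \<theta>"
    "finite (fibre (with_consts C) \<theta> x z m)" "a \<in> fibre (with_consts C) \<theta> x z m"
    using assms(1) by (auto simp: linked_def)
  obtain N where N: "\<And>i. i \<ge> N \<Longrightarrow> i \<notin> fv \<theta> \<union> {x, z}" using fresh_vars[of \<theta> x z] by blast
  let ?\<delta> = "fibre_fm \<theta> x z N (Suc N)"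
  have "a \<in> univ C" using \<theta>(3) by (auto simp: fibre_def)
  define v where "v = (\<lambda>_. m)(N := a)"
  have v: "range (v(N := d)) \<subseteq> univ C" if "d \<in> univ C" for d
    using that assms(2) univ_subset by (auto simp: v_def)
  have sat: "sat (with_consts C) (v(N := d)) ?\<delta> \<longleftrightarrow> d \<in> fibre (with_consts C) \<theta> x z m"
    if "d \<in> univ C" for d
    using sat_fibre_fm[OF N N, of N "Suc N" "v(N := d)" "with_consts C"] v[OF that]
    by (simp add: v_def)
  have "{d \<in> univ M. sat (with_consts C) (v(N := d)) ?\<delta>} \<subseteq> fibre (with_consts C) \<theta> x z m"
    using sat univ_subset by auto
  then have "finite {d \<in> univ M. sat (with_consts C) (v(N := d)) ?\<delta>}"
    using \<theta>(2) finite_subset by blast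
  moreover have "v(N := a) = v" by (simp add: v_def)
  moreover have "v i \<in> univ M" if "i \<in> fv ?\<delta> - {N}" for i using that assms(2) by (auto simp: v_def)
  ultimately have "v N \<in> univ M"
    using finitely_many_solutions_in[of ?\<delta> v N] sat[of a] v[of a] \<theta> \<open>a \<in> univ C\<close> by auto
  then show ?thesis by (simp add: v_def)
qed

text \<open>
  If \<open>\<theta>\<close> links \<open>a\<close> to \<open>b\<close> and \<open>\<eta>\<close> links \<open>b\<close> to \<open>c\<close>, then \<open>a\<close> satisfies the formula that some
  element of the fibre of \<open>\<eta>\<close> over \<open>c\<close> has the given element in its fibre of \<open>\<theta>\<close>. Its
  solutions form a finite union of finite fibres. Because every fibre of \<open>\<theta>\<close> is finite, and not
  just the one over \<open>b\<close>, no counting has to be built into the formula.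
\<close>

lemma linked_trans_acl:
  assumes "linked a b" "linked b c" shows "a \<in> acl L C (univ M \<union> {c})"
proof -
  obtain \<theta> x z where \<theta>: "wf_fm (add_consts L (univ M)) \<theta>"
    "\<And>d. finite (fibre (with_consts C) \<theta> x z d)" "a \<in> fibre (with_consts C) \<theta> x z b"
    using assms(1) by (auto simp: linked_def)
  obtain \<eta> y t where \<eta>: "wf_fm (add_consts L (univ M)) \<eta>"
    "\<And>d. finite (fibre (with_consts C) \<eta> y t d)" "b \<in> fibre (with_consts C) \<eta> y t c"
    using assms(2) by (auto simp: linked_def)
  obtain N1 N2 where N12: "\<And>i. i \<ge> N1 \<Longrightarrow> i \<notin> fv \<theta> \<union> {x, z}" "\<And>i. i \<ge> N2 \<Longrightarrow> i \<notin> fv \<eta> \<union> {y, t}"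
    using fresh_vars[of \<theta> x z] fresh_vars[of \<eta> y t] by blast
  define N where "N = max N1 N2"
  have N: "\<And>i. i \<ge> N \<Longrightarrow> i \<notin> fv \<theta> \<union> {x, z}" "\<And>i. i \<ge> N \<Longrightarrow> i \<notin> fv \<eta> \<union> {y, t}"
    using N12 by (auto simp: N_def)
  define q r where "q = N + 1" and "r = N + 2"
  \<comment> \<open>the parameter \<open>c\<close> enters by equating the bound variable \<open>r\<close> with its constant\<close>
  define \<chi> where "\<chi> = Ex r (Conj (Eq (Var r) (Fun (Inr c) []))
    (Ex q (Conj (fibre_fm \<theta> x z N q) (fibre_fm \<eta> y t q r))))"
  have "wf_fm (add_consts L (univ M \<union> {c})) \<theta>" "wf_fm (add_consts L (univ M \<union> {c})) \<eta>"
    using wf_fm_add_consts_mono \<theta>(1) \<eta>(1) by blast+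
  then have wf: "wf_fm (add_consts L (univ M \<union> {c})) \<chi>" by (simp add: \<chi>_def)
  have fv: "fv \<chi> \<subseteq> {N}"
    using fv_fibre_fm[of \<theta> x z N q] fv_fibre_fm[of \<eta> y t q r] by (auto simp: \<chi>_def)
  have inC: "a \<in> univ C" "b \<in> univ C" "c \<in> univ C" using \<theta>(3) \<eta>(3) by (auto simp: fibre_def)
  have sat: "sat (with_consts C) v \<chi> \<longleftrightarrow>
      (\<exists>d. v N \<in> fibre (with_consts C) \<theta> x z d \<and> d \<in> fibre (with_consts C) \<eta> y t c)"
    if v: "range v \<subseteq> univ C" for v
  proof -
    have "sat (with_consts C) (v(r := c, q := d)) (fibre_fm \<theta> x z N q) \<longleftrightarrow>
        v N \<in> fibre (with_consts C) \<theta> x z d"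
      "sat (with_consts C) (v(r := c, q := d)) (fibre_fm \<eta> y t q r) \<longleftrightarrow>
        d \<in> fibre (with_consts C) \<eta> y t c" if "d \<in> univ C" for d
    proof -
      have "range (v(r := c, q := d)) \<subseteq> univ (with_consts C)" using v that inC by auto
      from sat_fibre_fm[OF N(1) N(1) this, of N q] sat_fibre_fm[OF N(2) N(2) this, of q r]
      show "sat (with_consts C) (v(r := c, q := d)) (fibre_fm \<theta> x z N q) \<longleftrightarrow>
          v N \<in> fibre (with_consts C) \<theta> x z d"
        "sat (with_consts C) (v(r := c, q := d)) (fibre_fm \<eta> y t q r) \<longleftrightarrow>
          d \<in> fibre (with_consts C) \<eta> y t c"
        by (simp_all add: q_def r_def)
    qed
    moreover have "fibre (with_consts C) \<eta> y t c \<subseteq> univ C" by (auto simp: fibre_def)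
    ultimately show ?thesis using inC by (auto simp: \<chi>_def)
  qed
  have "solutions (with_consts C) \<chi> [N] \<subseteq>
      (\<lambda>d. [d]) ` (\<Union>d\<in>fibre (with_consts C) \<eta> y t c. fibre (with_consts C) \<theta> x z d)"
  proof
    fix l assume "l \<in> solutions (with_consts C) \<chi> [N]"
    then obtain v where "range v \<subseteq> univ C" "sat (with_consts C) v \<chi>" "l = [v N]"
      by (auto simp: solutions_def)
    then show "l \<in> (\<lambda>d. [d]) ` (\<Union>d\<in>fibre (with_consts C) \<eta> y t c. fibre (with_consts C) \<theta> x z d)"
      using sat[of v] by blast
  qed
  then have fin: "finite (solutions (with_consts C) \<chi> [N])"
    using \<theta>(2) \<eta>(2) by (meson finite_UN finite_imageI finite_subset)
  have "sat (with_consts C) (\<lambda>_. a) \<chi>" using sat[of "\<lambda>_. a"] \<theta>(3) \<eta>(3) inC by auto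
  then have "[a] \<in> solutions (with_consts C) \<chi> [N]"
    using inC by (auto simp: solutions_def intro!: exI[of _ "\<lambda>_. a"])
  with wf fv fin inC(1) show ?thesis unfolding acl_def by blast
qed

end

section \<open>Mutually algebraic structures\<close>

lemma nths_single: "j < length l \<Longrightarrow> nths l {j} = [l ! j]"
proof (induction l arbitrary: j)
  case (Cons a l)
  have "{i. Suc i \<in> {j}} = (if j = 0 then {} else {j - 1})" by auto
  then show ?case using Cons by (cases j) (auto simp: nths_Cons)
qed simp

locale mutually_algebraic_pair = elementary_pair L M C
  for L :: "('f, 'r) lang" and M C :: "('a, 'f, 'r) fo_struct" +
  assumes mut_alg: "mut_alg_struct L M"
begin

lemma MA_finite_fibres:
  assumes wf: "wf_fm (add_consts L (univ M)) \<theta>" and zs: "distinct zs" "fv \<theta> \<subseteq> set zs"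
    and ma: "mut_alg_set (univ M) (length zs) (solutions (with_consts M) \<theta> zs)"
    and xz: "x \<in> set zs" "z \<in> set zs" "x \<noteq> z"
  shows "finite (fibre (with_consts C) \<theta> x z a)"
proof -
  obtain i j where ij: "i < length zs" "zs ! i = x" "j < length zs" "zs ! j = z"
    using xz(1,2) by (auto simp: in_set_conv_nth)
  then have "i \<noteq> j" using xz(3) by auto
  let ?S = "solutions (with_consts M) \<theta> zs"
  from ma obtain K where K: "\<forall>X Y. X \<union> Y = {..<length zs} \<and> X \<inter> Y = {} \<and> X \<noteq> {} \<and> Y \<noteq> {} \<longrightarrow>
      (\<forall>c. finite {b \<in> ?S. nths b Y = c} \<and> card {b \<in> ?S. nths b Y = c} \<le> K)"
    unfolding mut_alg_set_def by (elim conjE exE)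
  have fin: "finite {b \<in> ?S. nths b {j} = c} \<and> card {b \<in> ?S. nths b {j} = c} \<le> K" for c
    by (rule K[rule_format, of "{..<length zs} - {j}"]) (use ij \<open>i \<noteq> j\<close> in auto)
  have "fibre (with_consts M) \<theta> x z c \<subseteq> (\<lambda>b. b ! i) ` {b \<in> ?S. nths b {j} = [c]}" for c
  proof
    fix d assume "d \<in> fibre (with_consts M) \<theta> x z c"
    then obtain w where w: "range w \<subseteq> univ M" "sat (with_consts M) w \<theta>" "w x = d" "w z = c"
      by (auto simp: fibre_def)
    then have "map w zs \<in> {b \<in> ?S. nths b {j} = [c]}"
      using ij by (auto simp: solutions_def nths_single)
    moreover have "d = map w zs ! i" using w ij by simp
    ultimately show "d \<in> (\<lambda>b. b ! i) ` {b \<in> ?S. nths b {j} = [c]}" by blast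
  qed
  then have "finite (fibre (with_consts M) \<theta> x z c) \<and> card (fibre (with_consts M) \<theta> x z c) \<le> K" for c
    using fin[of "[c]"] by (meson surj_card_le finite_surj order_trans)
  then show ?thesis using finite_fibre_ascends[OF wf] by blast
qed

text \<open>
  If \<open>v x\<close> is linked to no other coordinate of \<open>v\<close>, then the truth value of a boolean combination
  at \<open>v\<close> depends, up to finitely many exceptional values of \<open>x\<close>, only on an \<open>L(M)\<close>-formula \<open>\<delta>\<close>
  in \<open>x\<close> alone. A mutually algebraic constituent that does not involve \<open>x\<close> is unaffected by a change
  of \<open>x\<close>; one in \<open>x\<close> alone goes, possibly negated, into \<open>\<delta>\<close>; any other is false at \<open>v\<close>, for
  otherwise it would be a link, and is made true by the values of \<open>x\<close> in one finite fibre only.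
\<close>

lemma bool_comb_isolated:
  assumes v: "range v \<subseteq> univ C" and unlinked: "\<And>z. z \<noteq> x \<Longrightarrow> \<not> linked (v x) (v z)"
    and "\<psi> \<in> bool_combs (MA L M)"
  shows "\<exists>\<delta>. wf_fm (add_consts L (univ M)) \<delta> \<and> fv \<delta> \<subseteq> {x} \<and> sat (with_consts C) v \<delta> \<and>
    finite {d \<in> univ C. sat (with_consts C) (v(x := d)) \<delta> \<and>
      sat (with_consts C) (v(x := d)) \<psi> \<noteq> sat (with_consts C) v \<psi>}"
  using assms(3)
proof induction
  case (1 \<theta>)
  then obtain zs where wf: "wf_fm (add_consts L (univ M)) \<theta>" and zs: "distinct zs" "fv \<theta> \<subseteq> set zs"
    and ma: "mut_alg_set (univ M) (length zs) (solutions (with_consts M) \<theta> zs)"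
    by (auto simp: MA_def)
  let ?T = "Eq (Var x) (Var x) :: ('f + 'a, 'r) fm"
  consider "x \<notin> fv \<theta>" | "fv \<theta> \<subseteq> {x}" | z where "x \<in> set zs" "z \<in> set zs" "z \<noteq> x"
    using zs(2) by blast
  then show ?case
  proof cases
    case 1
    then have "sat (with_consts C) (v(x := d)) \<theta> = sat (with_consts C) v \<theta>" for d
      by (intro sat_cong) auto
    then show ?thesis by (intro exI[of _ ?T]) (simp del: fun_upd_apply)
  next
    case 2
    show ?thesis
    proof (cases "sat (with_consts C) v \<theta>")
      case True
      then show ?thesis using 2 wf by (intro exI[of _ \<theta>]) auto
    next
      case False
      then show ?thesis using 2 wf by (intro exI[of _ "Neg \<theta>"]) auto
    qed
  next
    case (3 z)
    have fin: "finite (fibre (with_consts C) \<theta> x z c) \<and> finite (fibre (with_consts C) \<theta> z x c)" for c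
      using MA_finite_fibres[OF wf zs ma] 3 by blast
    have "\<not> sat (with_consts C) v \<theta>"
    proof
      assume "sat (with_consts C) v \<theta>"
      then have "v x \<in> fibre (with_consts C) \<theta> x z (v z)" using v by (intro fibreI) auto
      then have "linked (v x) (v z)" using wf fin unfolding linked_def by blast
      then show False using unlinked 3 by blast
    qed
    moreover have "d \<in> fibre (with_consts C) \<theta> x z (v z)"
      if "d \<in> univ C" "sat (with_consts C) (v(x := d)) \<theta>" for d
    proof -
      have "range (v(x := d)) \<subseteq> univ (with_consts C)" using v that by auto
      from fibreI[OF this that(2), of x z] show ?thesis using 3 by simp
    qed
    ultimately have "{d \<in> univ C. sat (with_consts C) (v(x := d)) ?T \<and>
        sat (with_consts C) (v(x := d)) \<theta> \<noteq> sat (with_consts C) v \<theta>}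
        \<subseteq> fibre (with_consts C) \<theta> x z (v z)" by auto
    then have "finite {d \<in> univ C. sat (with_consts C) (v(x := d)) ?T \<and>
        sat (with_consts C) (v(x := d)) \<theta> \<noteq> sat (with_consts C) v \<theta>}"
      using fin by (blast intro: finite_subset)
    then show ?thesis by (intro exI[of _ ?T]) (simp del: fun_upd_apply)
  qed
next
  case (2 \<psi>)
  then show ?case by simp
next
  case (3 \<psi>1 \<psi>2)
  then obtain \<delta>1 \<delta>2 where \<delta>:
    "wf_fm (add_consts L (univ M)) \<delta>1" "fv \<delta>1 \<subseteq> {x}" "sat (with_consts C) v \<delta>1"
    "finite {d \<in> univ C. sat (with_consts C) (v(x := d)) \<delta>1 \<and>
      sat (with_consts C) (v(x := d)) \<psi>1 \<noteq> sat (with_consts C) v \<psi>1}" (is "finite ?F1")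
    "wf_fm (add_consts L (univ M)) \<delta>2" "fv \<delta>2 \<subseteq> {x}" "sat (with_consts C) v \<delta>2"
    "finite {d \<in> univ C. sat (with_consts C) (v(x := d)) \<delta>2 \<and>
      sat (with_consts C) (v(x := d)) \<psi>2 \<noteq> sat (with_consts C) v \<psi>2}" (is "finite ?F2")
    by blast
  have "finite {d \<in> univ C. sat (with_consts C) (v(x := d)) (Conj \<delta>1 \<delta>2) \<and>
      sat (with_consts C) (v(x := d)) (Conj \<psi>1 \<psi>2) \<noteq> sat (with_consts C) v (Conj \<psi>1 \<psi>2)}"
    by (rule finite_subset[of _ "?F1 \<union> ?F2"]) (use \<delta> in auto)
  then show ?case using \<delta> by (intro exI[of _ "Conj \<delta>1 \<delta>2"]) (simp del: fun_upd_apply)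
qed

text \<open>
  Without a link, the formula \<open>\<delta>\<close> for \<open>x\<close> has infinitely many solutions in \<open>M\<close>, since it has one
  outside \<open>M\<close>, and only finitely many of them can disagree with \<open>v x\<close> about \<open>\<phi>\<close>.
\<close>

lemma linked_or_infinitely_many:
  assumes wf: "wf_fm (add_consts L (univ M)) \<phi>" and v: "range v \<subseteq> univ C"
    and sat: "sat (with_consts C) v \<phi>" and new: "v x \<notin> univ M"
  shows "(\<exists>z. z \<noteq> x \<and> linked (v x) (v z)) \<or> infinite {m \<in> univ M. sat (with_consts C) (v(x := m)) \<phi>}"
proof (rule disjCI)
  assume fin: "\<not> infinite {m \<in> univ M. sat (with_consts C) (v(x := m)) \<phi>}"
  obtain \<psi> where \<psi>: "\<psi> \<in> bool_combs (MA L M)" "Th_equiv (add_consts L (univ M)) (with_consts M) \<phi> \<psi>"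
    using mut_alg wf by (auto simp: mut_alg_struct_def MA_star_def)
  show "\<exists>z. z \<noteq> x \<and> linked (v x) (v z)"
  proof (rule ccontr)
    assume "\<not> (\<exists>z. z \<noteq> x \<and> linked (v x) (v z))"
    then obtain \<delta> where \<delta>: "wf_fm (add_consts L (univ M)) \<delta>" "fv \<delta> \<subseteq> {x}" "sat (with_consts C) v \<delta>"
      "finite {d \<in> univ C. sat (with_consts C) (v(x := d)) \<delta> \<and>
        sat (with_consts C) (v(x := d)) \<psi> \<noteq> sat (with_consts C) v \<psi>}" (is "finite ?E")
      using bool_comb_isolated[OF v _ \<psi>(1)] by blast
    have "range (v(x := d)) \<subseteq> univ C" if "d \<in> univ C" for d using v that by auto
    then have eq: "sat (with_consts C) (v(x := d)) \<psi> \<longleftrightarrow> sat (with_consts C) (v(x := d)) \<phi>"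
      if "d \<in> univ C" for d using Th_equiv_sat[OF \<psi>(2)] that by blast
    have "sat (with_consts C) v \<psi>" using Th_equiv_sat[OF \<psi>(2) v] sat by simp
    then have "{m \<in> univ M. sat (with_consts C) (v(x := m)) \<delta>} \<subseteq>
        {m \<in> univ M. sat (with_consts C) (v(x := m)) \<phi>} \<union> ?E"
      using eq univ_subset by auto
    then have "finite {m \<in> univ M. sat (with_consts C) (v(x := m)) \<delta>}"
      using fin \<delta>(4) by (meson finite_UnI finite_subset)
    from finitely_many_solutions_in[OF \<delta>(1) v _ \<delta>(3) this] show False using \<delta>(2) new by auto
  qed
qed

text \<open>
  A formula witnessing \<open>e \<in> acl(M \<union> {b})\<close> has only finitely many solutions, so \<open>e\<close> is
  linked to one of its parameters. These lie in \<open>M \<union> {b}\<close>, and a link to \<open>M\<close> would put \<open>e\<close> into \<open>M\<close>.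
\<close>

lemma acl_imp_linked:
  assumes e: "e \<in> acl L C (univ M \<union> {b})" "e \<notin> univ M" and b: "b \<in> univ C"
  shows "linked e b"
proof -
  obtain \<chi> x where \<chi>: "wf_fm (add_consts L (univ M \<union> {b})) \<chi>" "fv \<chi> \<subseteq> {x}"
    "finite (solutions (with_consts C) \<chi> [x])" "[e] \<in> solutions (with_consts C) \<chi> [x]"
    using e(1) by (auto simp: acl_def)
  then obtain w where w: "range w \<subseteq> univ C" "sat (with_consts C) w \<chi>" "w x = e"
    by (auto simp: solutions_def)
  obtain g :: "nat \<Rightarrow> 'a" where g: "range g \<subseteq> univ M \<union> {b}" "{a. Inr a \<in> set1_fm \<chi>} \<subseteq> range g"
    by (rule enumerate_consts[OF \<chi>(1)]) auto
  \<comment> \<open>all coordinates other than the one of \<open>e\<close> are kept inside \<open>M \<union> {b}\<close>, including those of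
    variables that do not occur in \<open>\<chi>\<close>: the link found below may involve any of them\<close>
  define v where "v = (\<lambda>_. b)(x := e)"
  define u where "u = interleave v g"
  have vC: "range (v(x := d)) \<subseteq> univ C" if "d \<in> univ C" for d using that b by (auto simp: v_def)
  have sat: "sat (with_consts C) (u(2 * x := d)) (lift_fm (unconst g \<chi>)) \<longleftrightarrow>
      sat (with_consts C) (v(x := d)) \<chi>" for d
    by (simp add: u_def sat_unconst[OF g(2)] flip: interleave_upd)
  have eC: "e \<in> univ C" using w by auto
  have uC: "range u \<subseteq> univ C"
  proof -
    have "range v \<subseteq> univ C" using vC[OF eC] by (simp add: v_def)
    then show ?thesis using range_interleave[of v g] g(1) b univ_subset unfolding u_def by blast
  qed
  have "v(x := e) = v" "u(2 * x := e) = u" by (auto simp: v_def u_def simp flip: interleave_upd)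
  moreover have "sat (with_consts C) v \<chi>"
  proof -
    have "v i = w i" if "i \<in> fv \<chi>" for i using that w(3) \<chi>(2) by (auto simp: v_def)
    then show ?thesis using w(2) sat_cong[of \<chi> v w "with_consts C"] by blast
  qed
  ultimately have satu: "sat (with_consts C) u (lift_fm (unconst g \<chi>))" using sat[of e] by simp
  have "[m] \<in> solutions (with_consts C) \<chi> [x]"
    if m: "m \<in> univ M" "sat (with_consts C) (v(x := m)) \<chi>" for m
  proof -
    have "range (v(x := m)) \<subseteq> univ C" using vC m(1) univ_subset by blast
    from solutionsI[OF _ m(2), of "[x]"] this show ?thesis by simp
  qed
  then have "{m \<in> univ M. sat (with_consts C) (u(2 * x := m)) (lift_fm (unconst g \<chi>))} \<subseteq>
      hd ` solutions (with_consts C) \<chi> [x]"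
    unfolding sat by force
  then have "finite {m \<in> univ M. sat (with_consts C) (u(2 * x := m)) (lift_fm (unconst g \<chi>))}"
    using \<chi>(3) finite_surj by blast
  moreover have ux: "u (2 * x) = e" by (simp add: u_def v_def)
  ultimately obtain z where z: "z \<noteq> 2 * x" "linked e (u z)"
    using linked_or_infinitely_many[OF wf_lift[OF wf_unconst[OF \<chi>(1)]] uC satu, of "2 * x"] e(2) by auto
  have "u z \<in> univ M \<union> {b}" using z(1) g(1) by (auto simp: u_def v_def interleave_def)
  then show ?thesis using z(2) linked_to_base e(2) by auto
qed

end

section \<open>The Tarski-Vaught test\<close>

lemma tarski_vaught:
  assumes C: "is_struct L C" and A: "A \<subseteq> univ C" "A \<noteq> {}"
    and tv: "\<And>\<phi> v x c. wf_fm L \<phi> \<Longrightarrow> range v \<subseteq> A \<Longrightarrow> c \<in> univ C \<Longrightarrow> sat C (v(x := c)) \<phi> \<Longrightarrow>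
      \<exists>a\<in>A. sat C (v(x := a)) \<phi>"
  shows "elem_substruct L (C\<lparr>univ := A\<rparr>) C"
proof -
  obtain a0 where a0: "a0 \<in> A" using A(2) by auto
  \<comment> \<open>closure under \<open>f\<close> is the test for the formula \<open>x = f(a\<^sub>0, \<dots>, a\<^sub>n)\<close>\<close>
  have closed: "fint C f as \<in> A" if f: "f \<in> funs L" "length as = farity L f" "set as \<subseteq> A" for f as
  proof -
    let ?n = "length as"
    let ?t = "Fun f (map Var [0..<?n])"
    define v where "v i = (if i < ?n then as ! i else a0)" for i
    have "range v \<subseteq> A" using f(3) a0 by (auto simp: v_def)
    have ev: "eval_tm C (v(?n := c)) ?t = fint C f as" for c
    proof -
      have "map (eval_tm C (v(?n := c))) (map Var [0..<?n]) = as"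
        by (rule nth_equalityI) (auto simp: v_def)
      then show ?thesis by (simp only: eval_tm.simps)
    qed
    have "fint C f as \<in> univ C" using C f A(1) unfolding is_struct_def by blast
    moreover have "wf_fm L (Eq (Var ?n) ?t)" using f by (simp add: list_all_iff)
    moreover have sat: "sat C (v(?n := c)) (Eq (Var ?n) ?t) \<longleftrightarrow> c = fint C f as" for c
      unfolding sat.simps ev by simp
    ultimately show ?thesis using tv[of "Eq (Var ?n) ?t" v "fint C f as" ?n] \<open>range v \<subseteq> A\<close> by auto
  qed
  then have sub: "substruct L (C\<lparr>univ := A\<rparr>) C"
    using C A by (auto simp: substruct_def is_struct_def)
  have ev: "eval_tm (C\<lparr>univ := A\<rparr>) v t = eval_tm C v t" for v t
  proof (induction t)
    case (Fun f ts)
    then have "map (eval_tm (C\<lparr>univ := A\<rparr>) v) ts = map (eval_tm C v) ts" by auto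
    then show ?case by (simp del: map_eq_conv)
  qed simp
  have "sat (C\<lparr>univ := A\<rparr>) v \<phi> \<longleftrightarrow> sat C v \<phi>" if "wf_fm L \<phi>" "range v \<subseteq> A" for \<phi> v
    using that
  proof (induction \<phi> arbitrary: v)
    case (Rel r ts)
    have "map (eval_tm (C\<lparr>univ := A\<rparr>) v) ts = map (eval_tm C v) ts" by (simp add: ev)
    then show ?case by (simp del: map_eq_conv)
  next
    case (Ex i \<phi>)
    have "sat (C\<lparr>univ := A\<rparr>) (v(i := a)) \<phi> \<longleftrightarrow> sat C (v(i := a)) \<phi>" if "a \<in> A" for a
      using Ex.prems that by (intro Ex.IH) auto
    then have "sat (C\<lparr>univ := A\<rparr>) v (Ex i \<phi>) \<longleftrightarrow> (\<exists>a\<in>A. sat C (v(i := a)) \<phi>)" by auto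
    also have "\<dots> \<longleftrightarrow> sat C v (Ex i \<phi>)" using A(1) tv[of \<phi> v _ i] Ex.prems by auto
    finally show ?case .
  qed (auto simp: ev)
  then show ?thesis using sub by (auto simp: elem_substruct_def)
qed

context mutually_algebraic_pair
begin

text \<open>
  The class of \<open>a\<close> is given as the set of all elements over which some \<open>e\<close> is algebraic. If \<open>c\<close> is
  linked to \<open>a\<close>, then \<open>e\<close> is linked to \<open>a\<close> and \<open>a\<close> to \<open>c\<close>, so \<open>e\<close> is algebraic over \<open>c\<close> too.
\<close>

lemma linked_stays_in_union_of_classes:
  assumes S: "S \<subseteq> acl_classes L M C" "A - univ M = \<Union> S" "univ M \<subseteq> A"
    and c: "c \<in> univ C" "linked c a" and a: "a \<in> A"
  shows "c \<in> A"
proof (cases "a \<in> univ M \<or> c \<in> univ M")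
  case True
  then show ?thesis using linked_to_base[OF c(2)] S(3) by blast
next
  case False
  then obtain X where X: "X \<in> S" "a \<in> X" using a S(2) by blast
  then obtain e where e: "e \<in> univ C - univ M" "X = acl_rel L M C `` {e}"
    using S(1) by (auto simp: quotient_def)
  then have "e \<in> acl L C (univ M \<union> {a})" "a \<in> univ C" using X(2) by (auto simp: acl_rel_def)
  then have "linked e a" using acl_imp_linked e(1) by blast
  then have "e \<in> acl L C (univ M \<union> {c})" using linked_trans_acl linked_sym[OF c(2)] by blast
  then have "c \<in> X" using e c(1) False by (auto simp: acl_rel_def)
  then show ?thesis using X(1) S(2) by blast
qed

lemma union_of_classes_elementary:
  assumes A: "univ M \<subseteq> A" "A \<subseteq> univ C" and S: "S \<subseteq> acl_classes L M C" "A - univ M = \<Union> S"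
  shows "elem_substruct L (C\<lparr>univ := A\<rparr>) C"
proof (rule tarski_vaught[OF struct_C A(2)])
  show "A \<noteq> {}" using A(1) univ_nonempty by auto
next
  fix \<phi> v x c
  assume \<phi>: "wf_fm L \<phi>" and v: "range v \<subseteq> A" and c: "c \<in> univ C" "sat C (v(x := c)) \<phi>"
  show "\<exists>a\<in>A. sat C (v(x := a)) \<phi>"
  proof (cases "c \<in> A")
    case False
    let ?v = "v(x := c)"
    have "range ?v \<subseteq> univ C" using v c(1) A(2) by auto
    moreover have "?v x \<notin> univ M" using False A(1) by auto
    ultimately consider z where "z \<noteq> x" "linked c (v z)" |
      "infinite {m \<in> univ M. sat (with_consts C) (?v(x := m)) (lift_fm \<phi>)}"
      using linked_or_infinitely_many[OF wf_lift[OF \<phi>], of ?v x] c(2) by auto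
    then show ?thesis
    proof cases
      case 1
      then have "c \<in> A" using linked_stays_in_union_of_classes[OF S A(1) c(1)] v by blast
      then show ?thesis using False by blast
    next
      case 2
      then obtain m where "m \<in> univ M" "sat C (v(x := m)) \<phi>" using not_finite_existsD by fastforce
      then show ?thesis using A(1) by auto
    qed
  qed (use c in blast)
qed

end

lemma elem_substruct_factor:
  assumes "elem_substruct L M C" "elem_substruct L N C" "univ M \<subseteq> univ N"
  shows "elem_substruct L M N"
proof -
  have N: "set as \<subseteq> univ N" if "set as \<subseteq> univ M" for as using that assms(3) by blast
  have "substruct L M N"
    using assms N unfolding elem_substruct_def substruct_def by simp
  moreover have "sat M v \<phi> \<longleftrightarrow> sat N v \<phi>" if "wf_fm L \<phi>" "range v \<subseteq> univ M" for \<phi> v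
    using assms that unfolding elem_substruct_def by (meson order_trans)
  ultimately show ?thesis by (auto simp: elem_substruct_def)
qed

lemma in_acl: "b \<in> X \<Longrightarrow> b \<in> univ C \<Longrightarrow> b \<in> acl L C X"
proof -
  assume b: "b \<in> X" "b \<in> univ C"
  let ?\<phi> = "Eq (Var 0) (Fun (Inr b) [])"
  have "solutions (with_consts C) ?\<phi> [0] = {[b]}"
    using b(2) by (auto simp: solutions_def intro!: exI[of _ "\<lambda>_. b"])
  then show ?thesis using b unfolding acl_def
    by (intro CollectI conjI exI[of _ ?\<phi>] exI[of _ 0]) auto
qed

theorem proposition4p2:
  fixes L :: "('f, 'r) lang" and M C :: "('a, 'f, 'r) fo_struct"
  assumes "infinite (univ M)"
    and "mut_alg_struct L M"
    and "elem_substruct L M C"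
    and "saturated L C"
    and "univ M \<prec> univ C" and "funs L \<prec> univ C" and "rels L \<prec> univ C"
  shows
    "(\<forall>A S. univ M \<subseteq> A \<and> A \<subseteq> univ C \<and> S \<subseteq> acl_classes L M C \<and> A - univ M = \<Union> S \<longrightarrow>
        substruct L (C\<lparr>univ := A\<rparr>) C \<and>
        elem_substruct L M (C\<lparr>univ := A\<rparr>) \<and> elem_substruct L (C\<lparr>univ := A\<rparr>) C) \<and>
     (\<forall>(N :: ('a, 'f, 'r) fo_struct) B.
        elem_substruct L M N \<and> elem_substruct L N C \<and> B \<subseteq> univ N - univ M \<and>
        (\<forall>X\<in>acl_classes L M C. X \<inter> (univ N - univ M) \<noteq> {} \<longrightarrow> (\<exists>!b. b \<in> B \<inter> X)) \<longrightarrow>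
        univ N = univ M \<union> (\<Union>b\<in>B. acl L C (univ M \<union> {b}) - univ M) \<and>
        (\<forall>b\<in>B. univ M \<inter> (acl L C (univ M \<union> {b}) - univ M) = {}) \<and>
        disjoint_family_on (\<lambda>b. acl L C (univ M \<union> {b}) - univ M) B)"
proof (intro conjI allI impI; elim conjE)
  interpret mutually_algebraic_pair L M C
    using assms by unfold_locales
  fix A S
  assume A: "univ M \<subseteq> A" "A \<subseteq> univ C" "S \<subseteq> acl_classes L M C" "A - univ M = \<Union> S"
  show AC: "elem_substruct L (C\<lparr>univ := A\<rparr>) C" by (rule union_of_classes_elementary[OF A])
  then show "substruct L (C\<lparr>univ := A\<rparr>) C" by (simp add: elem_substruct_def)
  show "elem_substruct L M (C\<lparr>univ := A\<rparr>)"
    using elem_substruct_factor[OF assms(3) AC] A(1) by simp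
next
  fix N :: "('a, 'f, 'r) fo_struct" and B
  assume MN: "elem_substruct L M N" and NC: "elem_substruct L N C" and B: "B \<subseteq> univ N - univ M"
    and reps: "\<forall>X\<in>acl_classes L M C. X \<inter> (univ N - univ M) \<noteq> {} \<longrightarrow> (\<exists>!b. b \<in> B \<inter> X)"
  interpret N: elementary_pair L N C using NC by unfold_locales
  have sub: "univ M \<subseteq> univ N" using MN by (simp add: elem_substruct_def substruct_def)
  \<comment> \<open>the class of \<open>e\<close>, as the elements over which \<open>e\<close> is algebraic: if \<open>e\<close> lies in the pieces of
    two representatives, then both representatives lie in the class of \<open>e\<close>\<close>
  define cls where "cls e = {b \<in> univ C - univ M. e \<in> acl L C (univ M \<union> {b})}" for e
  have uniq: "\<exists>!b. b \<in> B \<and> b \<in> cls e"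
    if "e \<in> univ C - univ M" "cls e \<inter> (univ N - univ M) \<noteq> {}" for e
  proof -
    have "cls e = acl_rel L M C `` {e}" using that(1) by (auto simp: cls_def acl_rel_def)
    then have "cls e \<in> acl_classes L M C" using that(1) by (auto simp: quotient_def)
    with reps that(2) show ?thesis by auto
  qed
  have accl: "acl L C (univ M \<union> {b}) \<subseteq> univ N" if "b \<in> B" for b
    using that B sub by (intro N.acl_closed) auto
  show "univ N = univ M \<union> (\<Union>b\<in>B. acl L C (univ M \<union> {b}) - univ M)"
  proof
    show "univ N \<subseteq> univ M \<union> (\<Union>b\<in>B. acl L C (univ M \<union> {b}) - univ M)"
    proof
      fix n assume n: "n \<in> univ N"
      show "n \<in> univ M \<union> (\<Union>b\<in>B. acl L C (univ M \<union> {b}) - univ M)"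
      proof (cases "n \<in> univ M")
        case False
        have nC: "n \<in> univ C" using n N.univ_subset by auto
        then have "n \<in> cls n" using False in_acl[of n "univ M \<union> {n}" C L] by (auto simp: cls_def)
        then obtain b where "b \<in> B" "b \<in> cls n" using uniq[of n] n nC False by blast
        then show ?thesis using False by (auto simp: cls_def)
      qed simp
    qed
  qed (use accl sub in auto)
  show "disjoint_family_on (\<lambda>b. acl L C (univ M \<union> {b}) - univ M) B"
    unfolding disjoint_family_on_def
  proof (intro ballI impI equals0I)
    fix b b' e
    assume b: "b \<in> B" "b' \<in> B" "b \<noteq> b'"
      and e: "e \<in> (acl L C (univ M \<union> {b}) - univ M) \<inter> (acl L C (univ M \<union> {b'}) - univ M)"
    then have "e \<in> univ C - univ M" by (auto simp: acl_def)
    moreover have "b \<in> cls e" "b' \<in> cls e" using e b B N.univ_subset by (auto simp: cls_def)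
    ultimately show False using uniq[of e] b B by blast
  qed
  show "\<forall>b\<in>B. univ M \<inter> (acl L C (univ M \<union> {b}) - univ M) = {}" by blast
qed

end
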